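(* Let $N=\{1,\ldots,n\}$ and let $C \subset \mathbb{Z}^n$ be a bounded integral hole-free set. The following statements are equivalent: (1) $C$ has a least weakly $(1,b)$-supermajorized element for each $b \in \mathbb{Z}^n$; (2) for each $b \in \mathbb{Z}^n$, there exists $x^* \in C$ that is an optimal solution to $\min_{x \in C} \Phi(x+b)$ for any choice of non-increasing continuous Schur-convex function $\Phi:\mathbb{R}^n\to\mathbb{R}$; (3) for each permutation $\pi$ of $N$, there exists $x^* \in C$ such that for all $x \in C$ we have $\sum_{i=1}^k x^*_{\pi(i)} \geq \sum_{i=1}^k x_{\pi(i)}$ for all $k \in N$; (4) the function $f(A) := \max_{x \in C} x(A)$, $A\subseteq N$, is integral and submodular and $B^{\mathbb{Z}}(f) \subseteq C \subseteq P^{\mathbb{Z}}(f)$.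
   Context: Notation: $x(A) := \sum_{i\in A} x_i$ for $x\in\mathbb{R}^n$, $A\subseteq N$; in "$(1,b)$", $1$ is the all-ones vector. "Integral" means integer-valued. A set $C\subseteq\mathbb{Z}^n$ is hole-free if $C=\mathrm{co}(C)\cap\mathbb{Z}^n$, where $\mathrm{co}$ denotes convex hull. Weak $(1,b)$-supermajorization: $x$ is weakly $(1,b)$-supermajorized by $y$ if $\sum_{i\in N}\phi(x_i+b_i)\le \sum_{i\in N}\phi(y_i+b_i)$ for all non-increasing continuous convex functions $\phi:\mathbb{R}\to\mathbb{R}$. A vector $x\in C$ is a least weakly $(1,b)$-supermajorized element of $C$ if $x$ is weakly $(1,b)$-supermajorized by every $y\in C$. Schur-convexity: let $x^{\downarrow}$ denote the rearrangement of $x$ in non-increasing order; $x\prec y$ if $\sum_{i=1}^k x^{\downarrow}_i\le\sum_{i=1}^k y^{\downarrow}_i$ for all $k\in N$ and $x(N)=y(N)$. $\Phi:\mathbb{R}^n\to\mathbb{R}$ is Schur-convex if $x\prec y$ implies $\Phi(x)\le\Phi(y)$. $\Phi$ is non-increasing if it is non-increasing with respect to the componentwise order. Submodularity: $f:2^N\to\mathbb{R}$ with $f(\emptyset)=0$ is submodular if $f(A)+f(B)\ge f(A\cup B)+f(A\cap B)$ for all $A,B\subseteq N$. $P^{\mathbb{Z}}(f):=\{x\in\mathbb{Z}^n : x(A)\le f(A)\ \forall A\subseteq N\}$ and $B^{\mathbb{Z}}(f):=\{x\in P^{\mathbb{Z}}(f): x(N)=f(N)\}$. *)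

theory Defs
  imports "HOL-Analysis.Analysis" "HOL-Library.Multiset"
begin

(* The ground set N = {1,...,n} is the universe of a finite type 'n with n = CARD('n), and a
   vector over N is an element of real^'n.  The order on real^'n is componentwise. *)

definition int_vecs :: "(real ^ 'n) set" where
  "int_vecs = {x. \<forall>i. x $ i \<in> \<int>}"

definition hole_free :: "(real ^ 'n) set \<Rightarrow> bool" where
  "hole_free C \<longleftrightarrow> C = (convex hull C) \<inter> int_vecs"

definition vsum :: "real ^ 'n \<Rightarrow> 'n set \<Rightarrow> real" where
  "vsum x A = (\<Sum>i\<in>A. x $ i)"

definition weakly_supermajorized :: "real ^ 'n \<Rightarrow> real ^ 'n \<Rightarrow> real ^ 'n \<Rightarrow> bool" where
  "weakly_supermajorized b x y \<longleftrightarrow>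
     (\<forall>\<phi> :: real \<Rightarrow> real. antimono \<phi> \<and> continuous_on UNIV \<phi> \<and> convex_on UNIV \<phi> \<longrightarrow>
        (\<Sum>i\<in>UNIV. \<phi> (x $ i + b $ i)) \<le> (\<Sum>i\<in>UNIV. \<phi> (y $ i + b $ i)))"

definition least_weakly_supermajorized :: "real ^ 'n \<Rightarrow> (real ^ 'n) set \<Rightarrow> real ^ 'n \<Rightarrow> bool" where
  "least_weakly_supermajorized b C x \<longleftrightarrow> x \<in> C \<and> (\<forall>y\<in>C. weakly_supermajorized b x y)"

definition decreasing_rearrangement :: "real ^ 'n \<Rightarrow> real list" where
  "decreasing_rearrangement x =
     rev (sorted_list_of_multiset (image_mset (\<lambda>i. x $ i) (mset_set UNIV)))"

(* List indices start at 0, so the sum over i < k runs over the k largest entries. *)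
definition majorized :: "real ^ 'n \<Rightarrow> real ^ 'n \<Rightarrow> bool" where
  "majorized x y \<longleftrightarrow>
     (\<forall>k\<in>{1..CARD('n)}. (\<Sum>i<k. decreasing_rearrangement x ! i)
                          \<le> (\<Sum>i<k. decreasing_rearrangement y ! i)) \<and>
     vsum x UNIV = vsum y UNIV"

definition schur_convex :: "(real ^ 'n \<Rightarrow> real) \<Rightarrow> bool" where
  "schur_convex \<Phi> \<longleftrightarrow> (\<forall>x y. majorized x y \<longrightarrow> \<Phi> x \<le> \<Phi> y)"

definition submodular :: "('n set \<Rightarrow> real) \<Rightarrow> bool" where
  "submodular f \<longleftrightarrow> f {} = 0 \<and> (\<forall>A B. f A + f B \<ge> f (A \<union> B) + f (A \<inter> B))"

definition int_polyhedron :: "('n set \<Rightarrow> real) \<Rightarrow> (real ^ 'n) set" where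
  "int_polyhedron f = {x \<in> int_vecs. \<forall>A. vsum x A \<le> f A}"

definition int_base_polyhedron :: "('n set \<Rightarrow> real) \<Rightarrow> (real ^ 'n) set" where
  "int_base_polyhedron f = {x \<in> int_polyhedron f. vsum x UNIV = f UNIV}"

(* A bounded set of integral vectors is finite, so the maximum is attained whenever C is nonempty.
   For C = {} the unspecified value Max {} is harmless: all four conditions below are false then
   (if Max {} = 0, the zero vector lies in the base polyhedron but not in C; otherwise
   max_fun C {} \<noteq> 0). *)
definition max_fun :: "(real ^ 'n) set \<Rightarrow> 'n set \<Rightarrow> real" where
  "max_fun C A = Max ((\<lambda>x. vsum x A) ` C)"

definition has_least_weakly_supermajorized :: "(real ^ 'n) set \<Rightarrow> bool" where
  "has_least_weakly_supermajorized C \<longleftrightarrow>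
     (\<forall>b\<in>int_vecs. \<exists>x. least_weakly_supermajorized b C x)"

definition has_common_schur_minimizer :: "(real ^ 'n) set \<Rightarrow> bool" where
  "has_common_schur_minimizer C \<longleftrightarrow>
     (\<forall>b\<in>int_vecs. \<exists>x'\<in>C. \<forall>\<Phi> :: real ^ 'n \<Rightarrow> real.
        antimono \<Phi> \<and> continuous_on UNIV \<Phi> \<and> schur_convex \<Phi> \<longrightarrow>
        (\<forall>x\<in>C. \<Phi> (x' + b) \<le> \<Phi> (x + b)))"

(* Permutations of N are rendered as enumerations of the index type. *)
definition has_prefix_sum_maximizer :: "(real ^ 'n) set \<Rightarrow> bool" where
  "has_prefix_sum_maximizer C \<longleftrightarrow>
     (\<forall>\<pi> :: nat \<Rightarrow> 'n. bij_betw \<pi> {1..CARD('n)} UNIV \<longrightarrow>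
        (\<exists>x'\<in>C. \<forall>x\<in>C. \<forall>k\<in>{1..CARD('n)}.
           (\<Sum>i=1..k. x' $ \<pi> i) \<ge> (\<Sum>i=1..k. x $ \<pi> i)))"

definition lies_between_polyhedra :: "(real ^ 'n) set \<Rightarrow> bool" where
  "lies_between_polyhedra C \<longleftrightarrow>
     (\<forall>A. max_fun C A \<in> \<int>) \<and> submodular (max_fun C) \<and>
     int_base_polyhedron (max_fun C) \<subseteq> C \<and> C \<subseteq> int_polyhedron (max_fun C)"

end

theory Submission
  imports Defs
begin

text \<open>The implications are proved in the cycle (2), (1), (3), (4), (2). A non-increasing convex
  \<open>\<phi>\<close> sums to a Schur-convex function by Abel summation against its subgradients. Shifts \<open>b\<close> with
  large gaps turn supermajorization into the comparison of prefix sums. Abel summation along the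
  order of a linear functional then shows that no hyperplane separates a point of the base
  polyhedron from \<open>C\<close>. Conversely, a base minimizing \<open>norm (x + b)\<close> admits no improving
  exchange, so its tight sets separate small from large coordinates of \<open>x + b\<close>. Hence it
  minimizes the sum of \<open>max 0 (c - (x\<^sub>i + b\<^sub>i))\<close> over all \<open>i\<close> for every integer \<open>c\<close>, which is weak
  supermajorization.\<close>

section \<open>Abel summation and subgradients\<close>

text \<open>Replacing \<open>g n\<close> by the no larger \<open>g (Suc n)\<close> in front of a
  nonnegative partial sum only lowers the product, which drives the induction. The weights may have
  either sign; the left side is nonnegative once the last weight is nonnegative or the total of
  \<open>d\<close> vanishes.\<close>

lemma abel_sum_ge:
  fixes g d :: "nat \<Rightarrow> real"
  assumes "\<And>i j. i \<le> j \<Longrightarrow> j \<le> n \<Longrightarrow> g j \<le> g i"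
    and "\<And>k. k \<le> n \<Longrightarrow> 0 \<le> (\<Sum>i\<le>k. d i)"
  shows "g n * (\<Sum>i\<le>n. d i) \<le> (\<Sum>i\<le>n. g i * d i)"
  using assms
proof (induction n)
  case 0
  then show ?case by simp
next
  case (Suc n)
  have "g (Suc n) * (\<Sum>i\<le>n. d i) \<le> g n * (\<Sum>i\<le>n. d i)"
    using Suc.prems(1)[of n "Suc n"] Suc.prems(2)[of n] by (intro mult_right_mono) auto
  also have "\<dots> \<le> (\<Sum>i\<le>n. g i * d i)"
    using Suc.prems by (intro Suc.IH) auto
  finally show ?case by (simp add: algebra_simps)
qed

lemma abel_sum_ge_card:
  fixes g d :: "nat \<Rightarrow> real"
  assumes "\<And>i j. i \<le> j \<Longrightarrow> j < CARD('n::finite) \<Longrightarrow> g j \<le> g i"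
    and "\<And>k. k \<le> CARD('n) \<Longrightarrow> 0 \<le> (\<Sum>i<k. d i)"
  shows "g (CARD('n) - 1) * (\<Sum>i<CARD('n). d i) \<le> (\<Sum>i<CARD('n). g i * d i)"
proof -
  obtain m where m: "CARD('n) = Suc m"
    using zero_less_card_finite[where 'a='n] gr0_implies_Suc by blast
  have "0 \<le> (\<Sum>i\<le>k. d i)" if "k \<le> m" for k
    using assms(2)[of "Suc k"] that m by (simp add: lessThan_Suc_atMost)
  then have "g m * (\<Sum>i\<le>m. d i) \<le> (\<Sum>i\<le>m. g i * d i)"
    using assms(1) m by (intro abel_sum_ge) auto
  then show ?thesis
    by (simp add: m lessThan_Suc_atMost)
qed

text \<open>The right derivative serves as \<open>g\<close>. Adding the subgradient inequalities at
  two points gives its monotonicity, and comparing \<open>x\<close> with \<open>x + 1\<close> gives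
  its sign.\<close>

lemma convex_antimono_subgradient:
  fixes \<phi> :: "real \<Rightarrow> real"
  assumes conv: "convex_on UNIV \<phi>" and anti: "antimono \<phi>"
  obtains g where "mono g" "\<And>x. g x \<le> 0" "\<And>x y. \<phi> x + g x * (y - x) \<le> \<phi> y"
proof -
  define g where "g x = Inf ((\<lambda>t. (\<phi> x - \<phi> t) / (x - t)) ` ({x<..} \<inter> UNIV))" for x
  have sub: "\<phi> x + g x * (y - x) \<le> \<phi> y" for x y
    using convex_le_Inf_differential[OF conv, of x y] by (simp add: g_def)
  have "g x \<le> g y" if "x \<le> y" for x y
  proof (cases "x = y")
    case False
    have "g x * (y - x) \<le> g y * (y - x)"
      using sub[of x y] sub[of y x] by (simp add: algebra_simps)
    then show ?thesis using False that by (simp add: mult_le_cancel_right)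
  qed simp
  moreover have "g x \<le> 0" for x
    using sub[of x "x + 1"] antimonoD[OF anti, of x "x + 1"] by simp
  ultimately show thesis using sub by (intro that[of g] monoI) auto
qed

section \<open>Ascending enumerations and majorization\<close>

text \<open>The order is ascending because weak supermajorization is governed by the sums of the
  smallest entries, which thus become prefix sums.\<close>

definition ascending_enum :: "(nat \<Rightarrow> 'n) \<Rightarrow> real ^ 'n \<Rightarrow> bool" where
  "ascending_enum \<pi> x \<longleftrightarrow> bij_betw \<pi> {..<CARD('n)} UNIV \<and>
     (\<forall>i j. i \<le> j \<longrightarrow> j < CARD('n) \<longrightarrow> x $ \<pi> i \<le> x $ \<pi> j)"

lemma ascending_enum_bij: "ascending_enum (\<pi> :: nat \<Rightarrow> 'n::finite) x \<Longrightarrow> bij_betw \<pi> {..<CARD('n)} UNIV"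
  and ascending_enum_le:
    "ascending_enum (\<pi> :: nat \<Rightarrow> 'n) x \<Longrightarrow> i \<le> j \<Longrightarrow> j < CARD('n) \<Longrightarrow> x $ \<pi> i \<le> x $ \<pi> j"
  by (auto simp: ascending_enum_def)

lemma ex_ascending_enum:
  fixes x :: "real ^ 'n"
  obtains \<pi> where "ascending_enum \<pi> x"
proof -
  obtain us :: "'n list" where us: "set us = UNIV" "distinct us"
    using finite_distinct_list[of "UNIV :: 'n set"] by auto
  define vs where "vs = sort_key (\<lambda>i. x $ i) us"
  have vs: "set vs = UNIV" "distinct vs" "sorted (map (\<lambda>i. x $ i) vs)"
    using us by (auto simp: vs_def)
  have len: "length vs = CARD('n)"
    using distinct_card[OF vs(2)] vs(1) by simp
  have "bij_betw ((!) vs) {..<CARD('n)} UNIV"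
    using bij_betw_nth[OF vs(2)] len vs(1) by simp
  moreover have "x $ (vs ! i) \<le> x $ (vs ! j)" if "i \<le> j" "j < CARD('n)" for i j
    using sorted_nth_mono[OF vs(3) that(1)] that len by simp
  ultimately show thesis
    by (intro that[of "(!) vs"]) (simp add: ascending_enum_def)
qed

lemma sum_enum:
  fixes \<pi> :: "nat \<Rightarrow> 'n::finite" and h :: "'n \<Rightarrow> real"
  assumes "bij_betw \<pi> {..<CARD('n)} UNIV"
  shows "(\<Sum>i\<in>UNIV. h i) = (\<Sum>i<CARD('n). h (\<pi> i))"
  using sum.reindex_bij_betw[OF assms, of h] by simp

lemma decreasing_rearrangement_eq:
  fixes x :: "real ^ 'n"
  assumes "ascending_enum \<pi> x"
  shows "decreasing_rearrangement x = rev (map (\<lambda>i. x $ \<pi> i) [0..<CARD('n)])"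
proof -
  have bij: "bij_betw \<pi> {..<CARD('n)} UNIV" using assms by (rule ascending_enum_bij)
  let ?xs = "map (\<lambda>i. x $ \<pi> i) [0..<CARD('n)]"
  have sorted: "sorted ?xs"
    using ascending_enum_le[OF assms] by (auto simp: sorted_iff_nth_mono)
  have "mset_set (UNIV :: 'n set) = image_mset \<pi> (mset_set {..<CARD('n)})"
    using bij by (metis bij_betw_def image_mset_mset_set)
  then have "image_mset (\<lambda>i. x $ i) (mset_set UNIV) = mset ?xs"
    by (simp add: multiset.map_comp o_def lessThan_atLeast0)
  then have "sorted_list_of_multiset (image_mset (\<lambda>i. x $ i) (mset_set UNIV)) = sort ?xs"
    by (simp del: mset_map)
  then show ?thesis
    using sorted by (simp add: decreasing_rearrangement_def sorted_sort_id del: map_eq_conv)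
qed

lemma sum_decreasing_rearrangement:
  fixes x :: "real ^ 'n"
  assumes asc: "ascending_enum \<pi> x" and k: "k \<le> CARD('n)"
  shows "(\<Sum>i<k. decreasing_rearrangement x ! i) =
    vsum x UNIV - (\<Sum>i<CARD('n) - k. x $ \<pi> i)"
proof -
  let ?n = "CARD('n)"
  have "(\<Sum>i<k. decreasing_rearrangement x ! i) = (\<Sum>i<k. x $ \<pi> (?n - Suc i))"
    using k by (intro sum.cong) (auto simp: decreasing_rearrangement_eq[OF asc] rev_nth)
  also have "\<dots> = (\<Sum>i=?n - k..<?n. x $ \<pi> i)"
    by (rule sum.reindex_bij_witness[of _ "\<lambda>i. ?n - Suc i" "\<lambda>i. ?n - Suc i"]) (use k in auto)
  also have "\<dots> = (\<Sum>i<?n. x $ \<pi> i) - (\<Sum>i<?n - k. x $ \<pi> i)"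
    using sum.atLeastLessThan_concat[of 0 "?n - k" ?n "\<lambda>i. x $ \<pi> i"]
    by (simp add: lessThan_atLeast0)
  finally show ?thesis
    using sum_enum[OF ascending_enum_bij[OF asc], of "\<lambda>i. x $ i"] by (simp add: vsum_def)
qed

text \<open>The largest entries sum to the total minus the remaining smallest ones, so equal totals
  reverse the comparison of partial sums.\<close>

lemma majorized_iff:
  fixes x y :: "real ^ 'n"
  assumes "ascending_enum \<pi> x" "ascending_enum \<rho> y"
  shows "majorized x y \<longleftrightarrow>
    (\<forall>k\<le>CARD('n). (\<Sum>i<k. y $ \<rho> i) \<le> (\<Sum>i<k. x $ \<pi> i)) \<and> vsum x UNIV = vsum y UNIV"
proof (cases "vsum x UNIV = vsum y UNIV")
  case True
  let ?n = "CARD('n)"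
  let ?P = "\<lambda>k. (\<Sum>i<k. y $ \<rho> i) \<le> (\<Sum>i<k. x $ \<pi> i)"
  have total: "?P ?n"
    using True sum_enum[OF ascending_enum_bij[OF assms(1)], of "\<lambda>i. x $ i"]
      sum_enum[OF ascending_enum_bij[OF assms(2)], of "\<lambda>i. y $ i"]
    by (simp add: vsum_def)
  have "majorized x y \<longleftrightarrow> (\<forall>k\<in>{1..?n}. ?P (?n - k))"
    using True by (auto simp: majorized_def sum_decreasing_rearrangement[OF assms(1)]
        sum_decreasing_rearrangement[OF assms(2)])
  \<comment> \<open>Lengths \<open>?n - k\<close> with \<open>k\<close> in \<open>{1..?n}\<close>
    miss only the full length \<open>?n\<close>, which \<open>total\<close> supplies.\<close>
  also have "\<dots> \<longleftrightarrow> (\<forall>k\<le>?n. ?P k)"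
  proof safe
    fix k assume *: "\<forall>k\<in>{1..?n}. ?P (?n - k)" and "k \<le> ?n"
    show "?P k"
    proof (cases "k = ?n")
      case True
      then show ?thesis using total by simp
    next
      case False
      then show ?thesis using bspec[OF *, of "?n - k"] \<open>k \<le> ?n\<close> by simp
    qed
  qed auto
  finally show ?thesis using True by simp
qed (simp add: majorized_def)

text \<open>Subgradients at the entries of \<open>x\<close> bound each difference of values below by
  \<open>h i * d i\<close>. Their negatives \<open>h\<close> are nonnegative and non-increasing
  along the enumeration, so Abel summation applies.\<close>

lemma sum_convex_antimono_le:
  fixes x y :: "real ^ 'n"
  assumes x: "ascending_enum \<pi> x" and y: "ascending_enum \<rho> y"
    and le: "\<And>k. k \<le> CARD('n) \<Longrightarrow> (\<Sum>i<k. y $ \<rho> i) \<le> (\<Sum>i<k. x $ \<pi> i)"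
    and \<phi>: "convex_on UNIV \<phi>" "antimono \<phi>"
  shows "(\<Sum>i\<in>UNIV. \<phi> (x $ i)) \<le> (\<Sum>i\<in>UNIV. \<phi> (y $ i))"
proof -
  let ?n = "CARD('n)"
  obtain g where g: "mono g" "\<And>x. g x \<le> 0" "\<And>x y. \<phi> x + g x * (y - x) \<le> \<phi> y"
    using convex_antimono_subgradient[OF \<phi>] by metis
  define h where "h i = - g (x $ \<pi> i)" for i
  define d where "d i = x $ \<pi> i - y $ \<rho> i" for i
  have d: "0 \<le> (\<Sum>i<k. d i)" if "k \<le> ?n" for k
    using le[OF that] by (simp add: d_def sum_subtractf)
  have "0 \<le> h (?n - 1) * (\<Sum>i<?n. d i)"
    using d[of ?n] g(2) by (simp add: h_def mult_nonpos_nonneg)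
  also have "\<dots> \<le> (\<Sum>i<?n. h i * d i)"
    using d monoD[OF g(1)] ascending_enum_le[OF x] by (intro abel_sum_ge_card) (auto simp: h_def)
  also have "\<dots> \<le> (\<Sum>i<?n. \<phi> (y $ \<rho> i) - \<phi> (x $ \<pi> i))"
  proof (rule sum_mono)
    fix i
    show "h i * d i \<le> \<phi> (y $ \<rho> i) - \<phi> (x $ \<pi> i)"
      using g(3)[of "x $ \<pi> i" "y $ \<rho> i"] by (simp add: h_def d_def algebra_simps)
  qed
  finally show ?thesis
    by (simp add: sum_subtractf sum_enum[OF ascending_enum_bij[OF x], of "\<lambda>i. \<phi> (x $ i)"]
        sum_enum[OF ascending_enum_bij[OF y], of "\<lambda>i. \<phi> (y $ i)"])
qed

section \<open>From Schur-convex minimizers to weak supermajorization\<close>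

lemma schur_minimizer_imp_least_supermajorized:
  fixes C :: "(real ^ 'n) set"
  assumes "has_common_schur_minimizer C"
  shows "has_least_weakly_supermajorized C"
  unfolding has_least_weakly_supermajorized_def
proof
  fix b :: "real ^ 'n" assume "b \<in> int_vecs"
  then obtain x where x: "x \<in> C" and min: "\<And>\<Phi> y. antimono \<Phi> \<Longrightarrow> continuous_on UNIV \<Phi> \<Longrightarrow>
      schur_convex \<Phi> \<Longrightarrow> y \<in> C \<Longrightarrow> \<Phi> (x + b) \<le> \<Phi> (y + b)"
    using assms unfolding has_common_schur_minimizer_def by meson
  have "weakly_supermajorized b x y" if "y \<in> C" for y
    unfolding weakly_supermajorized_def
  proof safe
    fix \<phi> :: "real \<Rightarrow> real"
    assume \<phi>: "antimono \<phi>" "continuous_on UNIV \<phi>" "convex_on UNIV \<phi>"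
    \<comment> \<open>This separable sum turns a test function of weak supermajorization into an
      admissible objective.\<close>
    define \<Phi> where "\<Phi> z = (\<Sum>i\<in>UNIV. \<phi> (z $ i))" for z :: "real ^ 'n"
    have "antimono \<Phi>"
      using \<phi>(1) by (auto simp: \<Phi>_def less_eq_vec_def antimono_def intro!: sum_mono)
    moreover have "continuous_on UNIV \<Phi>"
      unfolding \<Phi>_def
      by (intro continuous_intros continuous_on_compose2[OF \<phi>(2)]) auto
    moreover have "schur_convex \<Phi>"
      unfolding schur_convex_def
    proof safe
      fix u v :: "real ^ 'n" assume "majorized u v"
      obtain \<pi> where \<pi>: "ascending_enum \<pi> u" by (rule ex_ascending_enum)
      obtain \<rho> where \<rho>: "ascending_enum \<rho> v" by (rule ex_ascending_enum)
      show "\<Phi> u \<le> \<Phi> v"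
        unfolding \<Phi>_def using \<open>majorized u v\<close>
        by (intro sum_convex_antimono_le[OF \<pi> \<rho> _ \<phi>(3,1)]) (simp add: majorized_iff[OF \<pi> \<rho>])
    qed
    ultimately have "\<Phi> (x + b) \<le> \<Phi> (y + b)" using that by (rule min)
    then show "(\<Sum>i\<in>UNIV. \<phi> (x $ i + b $ i)) \<le> (\<Sum>i\<in>UNIV. \<phi> (y $ i + b $ i))"
      by (simp add: \<Phi>_def)
  qed
  then show "\<exists>x. least_weakly_supermajorized b C x"
    using x by (auto simp: least_weakly_supermajorized_def)
qed

section \<open>Finiteness and prefix sums\<close>

lemma finite_bounded_int_vecs:
  fixes C :: "(real ^ 'n) set"
  assumes "C \<subseteq> int_vecs" "bounded C"
  shows "finite C"
proof -
  obtain M where M: "\<And>x. x \<in> C \<Longrightarrow> norm x \<le> M"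
    using assms(2) by (auto simp: bounded_iff)
  have "C \<subseteq> vec_lambda ` (UNIV \<rightarrow>\<^sub>E {k \<in> \<int>. \<bar>k\<bar> \<le> M})"
  proof
    fix x assume x: "x \<in> C"
    have "\<bar>x $ i\<bar> \<le> M" for i
      using component_le_norm_cart[of x i] M[OF x] by linarith
    then have "($) x \<in> UNIV \<rightarrow>\<^sub>E {k \<in> \<int>. \<bar>k\<bar> \<le> M}"
      using assms(1) x by (auto simp: int_vecs_def)
    then show "x \<in> vec_lambda ` (UNIV \<rightarrow>\<^sub>E {k \<in> \<int>. \<bar>k\<bar> \<le> M})"
      by (rule image_eqI[rotated]) simp
  qed
  then show ?thesis
    by (rule finite_subset) (simp add: finite_PiE finite_abs_int_segment)
qed

text \<open>Shifts enumerations to start at 0, as in \<open>ascending_enum\<close> and Abel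
  summation. The empty prefix that is gained compares 0 with 0.\<close>

lemma has_prefix_sum_maximizer_iff:
  fixes C :: "(real ^ 'n) set"
  shows "has_prefix_sum_maximizer C \<longleftrightarrow>
     (\<forall>\<pi> :: nat \<Rightarrow> 'n. bij_betw \<pi> {..<CARD('n)} UNIV \<longrightarrow>
        (\<exists>x'\<in>C. \<forall>x\<in>C. \<forall>k\<le>CARD('n). (\<Sum>i<k. x $ \<pi> i) \<le> (\<Sum>i<k. x' $ \<pi> i)))"
    (is "_ \<longleftrightarrow> ?R")
proof
  assume C: "has_prefix_sum_maximizer C"
  show ?R
  proof safe
    fix \<pi> :: "nat \<Rightarrow> 'n" assume \<pi>: "bij_betw \<pi> {..<CARD('n)} UNIV"
    have "bij_betw (\<lambda>i. i - 1) {1..CARD('n)} {..<CARD('n)}"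
      by (rule bij_betw_byWitness[where f' = Suc]) auto
    from bij_betw_trans[OF this \<pi>] obtain x' where "x' \<in> C" and x': "\<And>x k. x \<in> C \<Longrightarrow>
        k \<in> {1..CARD('n)} \<Longrightarrow> (\<Sum>i=1..k. x $ \<pi> (i - 1)) \<le> (\<Sum>i=1..k. x' $ \<pi> (i - 1))"
      using C unfolding has_prefix_sum_maximizer_def o_def by meson
    have "(\<Sum>i<k. x $ \<pi> i) \<le> (\<Sum>i<k. x' $ \<pi> i)" if "x \<in> C" "k \<le> CARD('n)" for x k
      using x'[of x k] that
      by (cases "k = 0") (simp_all add: sum.atLeast1_atMost_eq)
    with \<open>x' \<in> C\<close> show "\<exists>x'\<in>C. \<forall>x\<in>C. \<forall>k\<le>CARD('n). (\<Sum>i<k. x $ \<pi> i) \<le> (\<Sum>i<k. x' $ \<pi> i)"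
      by blast
  qed
next
  assume R: ?R
  show "has_prefix_sum_maximizer C"
    unfolding has_prefix_sum_maximizer_def
  proof safe
    fix \<pi> :: "nat \<Rightarrow> 'n" assume \<pi>: "bij_betw \<pi> {1..CARD('n)} UNIV"
    have "bij_betw Suc {..<CARD('n)} {1..CARD('n)}"
      by (rule bij_betw_byWitness[where f' = "\<lambda>i. i - 1"]) auto
    from bij_betw_trans[OF this \<pi>] obtain x' where "x' \<in> C" and x': "\<And>x k. x \<in> C \<Longrightarrow>
        k \<le> CARD('n) \<Longrightarrow> (\<Sum>i<k. x $ \<pi> (Suc i)) \<le> (\<Sum>i<k. x' $ \<pi> (Suc i))"
      using R unfolding o_def by meson
    have "(\<Sum>i=1..k. x $ \<pi> i) \<le> (\<Sum>i=1..k. x' $ \<pi> i)" if "x \<in> C" "k \<in> {1..CARD('n)}" for x k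
      using x'[of x k] that by (simp add: sum.atLeast1_atMost_eq)
    with \<open>x' \<in> C\<close> show
      "\<exists>x'\<in>C. \<forall>x\<in>C. \<forall>k\<in>{1..CARD('n)}. (\<Sum>i=1..k. x $ \<pi> i) \<le> (\<Sum>i=1..k. x' $ \<pi> i)"
      by blast
  qed
qed

section \<open>From weak supermajorization to prefix sums\<close>

text \<open>Hinges are the test functions put into weak supermajorization; each is a maximum of two
  affine functions.\<close>

lemma antimono_convex_hinge:
  fixes c :: real
  shows "antimono (\<lambda>t. max 0 (c - t))" "continuous_on UNIV (\<lambda>t. max 0 (c - t))"
    "convex_on UNIV (\<lambda>t. max 0 (c - t))"
proof -
  show "antimono (\<lambda>t. max 0 (c - t))" by (auto simp: antimono_def)
  show "continuous_on UNIV (\<lambda>t. max 0 (c - t))" by (intro continuous_intros)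
  show "convex_on UNIV (\<lambda>t. max 0 (c - t))"
  proof (rule convex_onI)
    fix t x y :: real assume "0 < t" "t < 1"
    then have "(1 - t) * (c - x) \<le> (1 - t) * max 0 (c - x)" "t * (c - y) \<le> t * max 0 (c - y)"
      "0 \<le> (1 - t) * max 0 (c - x)" "0 \<le> t * max 0 (c - y)"
      by (auto intro: mult_left_mono)
    moreover have "c - ((1 - t) *\<^sub>R x + t *\<^sub>R y) = (1 - t) * (c - x) + t * (c - y)"
      by (simp add: algebra_simps)
    ultimately show "max 0 (c - ((1 - t) *\<^sub>R x + t *\<^sub>R y)) \<le>
        (1 - t) * max 0 (c - x) + t * max 0 (c - y)"
      by linarith
  qed simp
qed

text \<open>The shift \<open>b\<close> spreads the coordinates of \<open>x + b\<close> into disjoint intervals ordered by \<open>\<pi>\<close>, so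
  the hinge at height \<open>c\<close> between two such intervals sees exactly a prefix of \<open>\<pi>\<close>, and
  on that prefix it is affine.\<close>

lemma least_supermajorized_imp_prefix_sum_maximizer:
  fixes C :: "(real ^ 'n) set"
  assumes "bounded C" and least: "has_least_weakly_supermajorized C"
  shows "has_prefix_sum_maximizer C"
  unfolding has_prefix_sum_maximizer_iff
proof safe
  fix \<pi> :: "nat \<Rightarrow> 'n" assume \<pi>: "bij_betw \<pi> {..<CARD('n)} UNIV"
  let ?n = "CARD('n)"
  obtain B where B: "\<And>x. x \<in> C \<Longrightarrow> norm x \<le> B"
    using assms(1) by (auto simp: bounded_iff)
  define m where "m = nat \<lceil>B\<rceil>"
  have bound: "\<bar>x $ i\<bar> \<le> real m" if "x \<in> C" for x i
    using component_le_norm_cart[of x i] B[OF that] real_nat_ceiling_ge[of B]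
    unfolding m_def by linarith
  \<comment> \<open>On shifted points of \<open>C\<close> the coordinate at \<open>\<pi> i\<close>
    stays within \<open>m\<close> of \<open>2 * m * i\<close>, so neighbouring intervals meet at
    most in an endpoint. The height \<open>2 * m * k - m\<close> used below separates the indices
    below \<open>k\<close> from the others.\<close>
  define b :: "real ^ 'n" where
    "b = (\<chi> i. real (2 * m * the_inv_into {..<?n} \<pi> i))"
  have b: "b $ \<pi> i = real (2 * m * i)" if "i < ?n" for i
    using \<pi> that by (simp add: b_def the_inv_into_f_f bij_betw_def)
  have "b \<in> int_vecs" by (simp add: b_def int_vecs_def)
  then obtain x where x: "x \<in> C" and min: "\<And>y. y \<in> C \<Longrightarrow> weakly_supermajorized b x y"
    using least unfolding has_least_weakly_supermajorized_def least_weakly_supermajorized_def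
    by meson
  \<comment> \<open>The first sum on the right is the same for all \<open>y\<close>, so an
    inequality between hinge sums reverses into one between prefix sums.\<close>
  have hinge_sum: "(\<Sum>i\<in>UNIV. max 0 (real (2 * m * k) - real m - (y $ i + b $ i))) =
      (\<Sum>i<k. real (2 * m * k) - real m - real (2 * m * i)) - (\<Sum>i<k. y $ \<pi> i)"
    if y: "y \<in> C" and k: "k \<le> ?n" for y k
  proof -
    have "(\<Sum>i\<in>UNIV. max 0 (real (2 * m * k) - real m - (y $ i + b $ i))) =
        (\<Sum>i<?n. max 0 (real (2 * m * k) - real m - (y $ \<pi> i + real (2 * m * i))))"
      by (simp add: sum_enum[OF \<pi>] b)
    also have "\<dots> = (\<Sum>i<k. real (2 * m * k) - real m - (y $ \<pi> i + real (2 * m * i)))"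
    proof (rule sum.mono_neutral_cong_right)
      show "\<forall>i\<in>{..<?n} - {..<k}. max 0 (real (2 * m * k) - real m - (y $ \<pi> i + real (2 * m * i))) = 0"
      proof
        fix i assume "i \<in> {..<?n} - {..<k}"
        then have "real (2 * m * k) \<le> real (2 * m * i)"
          by (intro of_nat_mono mult_left_mono) auto
        then show "max 0 (real (2 * m * k) - real m - (y $ \<pi> i + real (2 * m * i))) = 0"
          using bound[OF y, of "\<pi> i"] by linarith
      qed
      fix i assume "i \<in> {..<k}"
      then have "2 * m * i + 2 * m \<le> 2 * m * k"
        using mult_left_mono[of "Suc i" k "2 * m"] by simp
      then have "real (2 * m * i) + 2 * real m \<le> real (2 * m * k)"
        using of_nat_mono[where 'a=real, of "2 * m * i + 2 * m" "2 * m * k"] by simp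
      then show "max 0 (real (2 * m * k) - real m - (y $ \<pi> i + real (2 * m * i))) =
          real (2 * m * k) - real m - (y $ \<pi> i + real (2 * m * i))"
        using bound[OF y, of "\<pi> i"] by linarith
    qed (use k in auto)
    finally show ?thesis by (simp add: sum_subtractf sum.distrib)
  qed
  have "(\<Sum>i<k. y $ \<pi> i) \<le> (\<Sum>i<k. x $ \<pi> i)" if y: "y \<in> C" and k: "k \<le> ?n" for y k
  proof -
    have "(\<Sum>i\<in>UNIV. max 0 (real (2 * m * k) - real m - (x $ i + b $ i))) \<le>
        (\<Sum>i\<in>UNIV. max 0 (real (2 * m * k) - real m - (y $ i + b $ i)))"
      using min[OF y] antimono_convex_hinge[of "real (2 * m * k) - real m"]
      unfolding weakly_supermajorized_def by blast
    then show ?thesis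
      unfolding hinge_sum[OF x k] hinge_sum[OF y k] by linarith
  qed
  with x show "\<exists>x'\<in>C. \<forall>x\<in>C. \<forall>k\<le>?n. (\<Sum>i<k. x $ \<pi> i) \<le> (\<Sum>i<k. x' $ \<pi> i)" by blast
qed

section \<open>From prefix sums to submodularity and bases\<close>

lemma vsum_int: "x \<in> int_vecs \<Longrightarrow> vsum x A \<in> \<int>"
  by (auto simp: int_vecs_def vsum_def)

lemma vsum_le_max_fun: "finite C \<Longrightarrow> x \<in> C \<Longrightarrow> vsum x A \<le> max_fun C A"
  by (simp add: max_fun_def)

lemma max_fun_attained:
  assumes "finite C" "C \<noteq> {}"
  obtains x where "x \<in> C" "vsum x A = max_fun C A"
proof -
  have "max_fun C A \<in> (\<lambda>x. vsum x A) ` C"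
    unfolding max_fun_def using assms by (intro Max_in) auto
  then show thesis using that by auto
qed

text \<open>One point of \<open>C\<close> attains \<open>max_fun C\<close> on a whole chain of
  prefixes. A chain through \<open>S \<inter> T\<close> and \<open>S \<union> T\<close> yields
  submodularity. The chain ordered by the normal of a separating hyperplane yields a point of
  \<open>C\<close> on the wrong side, which excludes integral bases outside
  \<open>C\<close>.\<close>

lemma prefix_sum_maximizer_imp_lies_between:
  fixes C :: "(real ^ 'n) set"
  assumes int: "C \<subseteq> int_vecs" and fin: "finite C" and hole_free: "hole_free C"
    and max: "has_prefix_sum_maximizer C"
  shows "lies_between_polyhedra C"
proof -
  let ?n = "CARD('n)" and ?f = "max_fun C"
  have ex_max: "\<exists>x'\<in>C. \<forall>x\<in>C. \<forall>k\<le>?n. (\<Sum>i<k. x $ \<pi> i) \<le> (\<Sum>i<k. x' $ \<pi> i)"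
    if "bij_betw \<pi> {..<?n} UNIV" for \<pi> :: "nat \<Rightarrow> 'n"
    using max that unfolding has_prefix_sum_maximizer_iff by blast
  \<comment> \<open>Any enumeration will do; the zero vector supplies one, so that
    \<open>ex_max\<close> provides an element of \<open>C\<close>.\<close>
  obtain \<pi>0 where "ascending_enum \<pi>0 (0 :: real ^ 'n)" by (rule ex_ascending_enum)
  from ex_max[OF ascending_enum_bij[OF this]] have "C \<noteq> {}" by auto
  have f_int: "?f A \<in> \<int>" for A
  proof -
    obtain x where "x \<in> C" "vsum x A = ?f A"
      using max_fun_attained[OF fin \<open>C \<noteq> {}\<close>] .
    then show ?thesis using vsum_int[of x A] int by auto
  qed
  have submod: "?f (S \<union> T) + ?f (S \<inter> T) \<le> ?f S + ?f T" for S T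
  proof -
    \<comment> \<open>The values are -2 on \<open>S \<inter> T\<close>, -1 on the rest of the union
      and 0 elsewhere, so an ascending enumeration lists the intersection first, then the rest of
      the union.\<close>
    define w :: "real ^ 'n" where "w = (\<chi> i. - (of_bool (i \<in> S) + of_bool (i \<in> T)))"
    obtain \<pi> where \<pi>: "ascending_enum \<pi> w" by (rule ex_ascending_enum)
    then obtain x where x: "x \<in> C" and le: "\<And>y k. y \<in> C \<Longrightarrow> k \<le> ?n \<Longrightarrow>
        (\<Sum>i<k. y $ \<pi> i) \<le> (\<Sum>i<k. x $ \<pi> i)"
      using ex_max[OF ascending_enum_bij] by meson
    \<comment> \<open>Such a set \<open>A\<close> occupies a prefix of \<open>\<pi>\<close>, so its
      indicator is a non-increasing weight for Abel summation.\<close>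
    have prefix_max: "?f A \<le> vsum x A"
      if A: "\<And>i j. w $ i \<le> w $ j \<Longrightarrow> j \<in> A \<Longrightarrow> i \<in> A" for A
    proof -
      obtain y where y: "y \<in> C" "vsum y A = ?f A"
        using max_fun_attained[OF fin \<open>C \<noteq> {}\<close>] .
      define g :: "nat \<Rightarrow> real" where "g i = of_bool (\<pi> i \<in> A)" for i
      define d where "d i = x $ \<pi> i - y $ \<pi> i" for i
      have d: "0 \<le> (\<Sum>i<k. d i)" if "k \<le> ?n" for k
        using le[OF y(1) that] by (simp add: d_def sum_subtractf)
      have "0 \<le> g (?n - 1) * (\<Sum>i<?n. d i)"
        using d by (simp add: g_def)
      also have "\<dots> \<le> (\<Sum>i<?n. g i * d i)"
        using d A[OF ascending_enum_le[OF \<pi>]] by (intro abel_sum_ge_card) (auto simp: g_def)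
      also have "\<dots> = (\<Sum>i\<in>UNIV. of_bool (i \<in> A) * (x $ i - y $ i))"
        by (simp add: sum_enum[OF ascending_enum_bij[OF \<pi>]] g_def d_def)
      also have "\<dots> = vsum x A - vsum y A"
      proof -
        have "(\<Sum>i\<in>UNIV. of_bool (i \<in> A) * (x $ i - y $ i)) = (\<Sum>i\<in>A. x $ i - y $ i)"
          by (rule sum.mono_neutral_cong_right) auto
        then show ?thesis by (simp add: vsum_def sum_subtractf)
      qed
      finally show ?thesis using y by simp
    qed
    have "?f (S \<union> T) \<le> vsum x (S \<union> T)" "?f (S \<inter> T) \<le> vsum x (S \<inter> T)"
      by (rule prefix_max; auto simp: w_def of_bool_def split: if_splits)+
    moreover have "vsum x (S \<union> T) + vsum x (S \<inter> T) = vsum x S + vsum x T"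
      by (simp add: vsum_def sum.union_inter)
    ultimately show ?thesis
      using vsum_le_max_fun[OF fin x, of S] vsum_le_max_fun[OF fin x, of T] by linarith
  qed
  have f_empty: "?f {} = 0"
  proof -
    obtain x where "x \<in> C" "vsum x {} = ?f {}"
      using max_fun_attained[OF fin \<open>C \<noteq> {}\<close>] .
    then show ?thesis by (simp add: vsum_def)
  qed
  have "z \<in> C" if z: "z \<in> int_base_polyhedron ?f" for z
  proof (rule ccontr)
    assume "z \<notin> C"
    \<comment> \<open>Hole-freeness excludes the integral point \<open>z\<close> from the hull as
      well.\<close>
    then have "z \<notin> convex hull C"
      using z hole_free
      by (auto simp: hole_free_def int_base_polyhedron_def int_polyhedron_def)
    moreover have "closed (convex hull C)"
      using fin by (intro compact_imp_closed finite_imp_compact_convex_hull)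
    ultimately obtain a \<beta> where z_less: "inner a z < \<beta>"
      and less: "\<And>x. x \<in> convex hull C \<Longrightarrow> \<beta> < inner a x"
      using separating_hyperplane_closed_point[of "convex hull C" z] by auto
    \<comment> \<open>Cheapest coordinates come first: the prefix maximizer along
      \<open>\<pi>\<close> is the greedy solution for minimizing \<open>inner a\<close>, and no
      integral base has a smaller value.\<close>
    obtain \<pi> where \<pi>: "ascending_enum \<pi> a" by (rule ex_ascending_enum)
    then obtain x where x: "x \<in> C" and le: "\<And>y k. y \<in> C \<Longrightarrow> k \<le> ?n \<Longrightarrow>
        (\<Sum>i<k. y $ \<pi> i) \<le> (\<Sum>i<k. x $ \<pi> i)"
      using ex_max[OF ascending_enum_bij] by meson
    have inj: "inj_on \<pi> {..<?n}" using ascending_enum_bij[OF \<pi>] by (simp add: bij_betw_def)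
    have vsum_prefix: "vsum y (\<pi> ` {..<k}) = (\<Sum>i<k. y $ \<pi> i)" if "k \<le> ?n" for k and y :: "real ^ 'n"
      using that by (simp add: vsum_def sum.reindex[OF inj_on_subset[OF inj]])
    have x_tight: "?f (\<pi> ` {..<k}) = (\<Sum>i<k. x $ \<pi> i)" if k: "k \<le> ?n" for k
    proof -
      obtain y where y: "y \<in> C" "vsum y (\<pi> ` {..<k}) = ?f (\<pi> ` {..<k})"
        using max_fun_attained[OF fin \<open>C \<noteq> {}\<close>] .
      have "?f (\<pi> ` {..<k}) \<le> (\<Sum>i<k. x $ \<pi> i)"
        using le[OF y(1) k] y(2) vsum_prefix[OF k, of y] by simp
      moreover have "(\<Sum>i<k. x $ \<pi> i) \<le> ?f (\<pi> ` {..<k})"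
        using vsum_le_max_fun[OF fin x, of "\<pi> ` {..<k}"] vsum_prefix[OF k, of x] by simp
      ultimately show ?thesis by (rule order_antisym)
    qed
    define d where "d i = x $ \<pi> i - z $ \<pi> i" for i
    have d: "0 \<le> (\<Sum>i<k. d i)" if "k \<le> ?n" for k
    proof -
      have "vsum z (\<pi> ` {..<k}) \<le> ?f (\<pi> ` {..<k})"
        using z by (simp add: int_base_polyhedron_def int_polyhedron_def)
      then show ?thesis
        using x_tight[OF that] vsum_prefix[OF that, of z] by (simp add: d_def sum_subtractf)
    qed
    have "\<pi> ` {..<?n} = UNIV" using ascending_enum_bij[OF \<pi>] by (simp add: bij_betw_def)
    then have "(\<Sum>i<?n. d i) = 0"
      using z x_tight[of ?n] vsum_prefix[of ?n z]
      by (simp add: d_def sum_subtractf int_base_polyhedron_def)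
    \<comment> \<open>The last entry of \<open>a\<close> may have any sign, which does no harm
      because \<open>x\<close> and \<open>z\<close> have equal totals.\<close>
    then have "0 = - (a $ \<pi> (?n - 1)) * (\<Sum>i<?n. d i)" by simp
    also have "\<dots> \<le> (\<Sum>i<?n. - (a $ \<pi> i) * d i)"
      using d ascending_enum_le[OF \<pi>] by (intro abel_sum_ge_card) auto
    also have "\<dots> = inner a z - inner a x"
      unfolding inner_vec_def
      by (simp add: sum_enum[OF ascending_enum_bij[OF \<pi>]] d_def algebra_simps sum_subtractf sum_negf
          sum.distrib)
    finally show False
      using z_less less[of x] x hull_inc[of x C convex] by linarith
  qed
  moreover have "C \<subseteq> int_polyhedron ?f"
    using int vsum_le_max_fun[OF fin] by (auto simp: int_polyhedron_def)
  ultimately show ?thesis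
    using f_int submod f_empty by (auto simp: lies_between_polyhedra_def submodular_def)
qed

section \<open>Tight sets and exchange\<close>

text \<open>For fixed \<open>i\<close>, intersecting the pairwise separators over \<open>J\<close>
  avoids all of \<open>J\<close>; uniting the results over \<open>I\<close> covers \<open>I\<close>.
  The sets \<open>UNIV\<close> and \<open>{}\<close> start the two inductions. The lattice in
  question will be that of tight sets.\<close>

lemma set_lattice_separation:
  fixes L :: "'a::finite set set"
  assumes "{} \<in> L" "UNIV \<in> L"
    and un: "\<And>S T. S \<in> L \<Longrightarrow> T \<in> L \<Longrightarrow> S \<union> T \<in> L"
    and int: "\<And>S T. S \<in> L \<Longrightarrow> T \<in> L \<Longrightarrow> S \<inter> T \<in> L"
    and sep: "\<And>i j. i \<in> I \<Longrightarrow> j \<in> J \<Longrightarrow> \<exists>T\<in>L. i \<in> T \<and> j \<notin> T"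
  obtains T where "T \<in> L" "I \<subseteq> T" "T \<inter> J = {}"
proof -
  have sep_one: "\<exists>T\<in>L. i \<in> T \<and> T \<inter> J = {}" if "i \<in> I" for i
    using finite[of J] sep[OF that]
  proof (induction J)
    case empty
    then show ?case using \<open>UNIV \<in> L\<close> by auto
  next
    case (insert j J)
    obtain S where S: "S \<in> L" "i \<in> S" "S \<inter> J = {}" using insert.IH insert.prems by auto
    obtain T where T: "T \<in> L" "i \<in> T" "j \<notin> T" using insert.prems[of j] by auto
    show ?case
      using S T int[OF S(1) T(1)] by (intro bexI[of _ "S \<inter> T"]) auto
  qed
  have "\<exists>T\<in>L. I \<subseteq> T \<and> T \<inter> J = {}"
    using finite[of I] sep_one
  proof (induction I)
    case empty
    then show ?case using \<open>{} \<in> L\<close> by auto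
  next
    case (insert i I)
    obtain S where S: "S \<in> L" "I \<subseteq> S" "S \<inter> J = {}" using insert.IH insert.prems by auto
    obtain T where T: "T \<in> L" "i \<in> T" "T \<inter> J = {}" using insert.prems[of i] by auto
    show ?case
      using S T un[OF S(1) T(1)] by (intro bexI[of _ "S \<union> T"]) auto
  qed
  then show thesis using that by blast
qed

lemma int_less_imp_add_one_le:
  fixes a b :: real
  assumes "a \<in> \<int>" "b \<in> \<int>" "a < b"
  shows "a + 1 \<le> b"
proof -
  obtain k l where "a = of_int k" "b = of_int l" using assms by (auto elim!: Ints_cases)
  with \<open>a < b\<close> show ?thesis by simp
qed

text \<open>A base closest to \<open>- b\<close> works. If no tight set contains \<open>i\<close>
  but not \<open>j\<close>, one unit can move from \<open>j\<close> to \<open>i\<close>; a gap above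
  1 would then make \<open>norm (x + b)\<close> smaller.\<close>

lemma ex_exchange_optimal_base:
  fixes f :: "'n::finite set \<Rightarrow> real"
  assumes fin: "finite (int_base_polyhedron f)" and ne: "int_base_polyhedron f \<noteq> {}"
    and f_int: "\<And>A. f A \<in> \<int>"
  obtains x where "x \<in> int_base_polyhedron f"
    "\<And>i j. x $ i + b $ i + 1 < x $ j + b $ j \<Longrightarrow> \<exists>T. vsum x T = f T \<and> i \<in> T \<and> j \<notin> T"
proof -
  obtain x where x: "x \<in> int_base_polyhedron f"
    and min: "\<And>y. y \<in> int_base_polyhedron f \<Longrightarrow> (norm (x + b))\<^sup>2 \<le> (norm (y + b))\<^sup>2"
    using ex_is_arg_min_if_finite[OF fin ne, of "\<lambda>y. (norm (y + b))\<^sup>2"]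
    unfolding is_arg_min_linorder by blast
  have "\<exists>T. vsum x T = f T \<and> i \<in> T \<and> j \<notin> T" if less: "x $ i + b $ i + 1 < x $ j + b $ j" for i j
  proof (rule ccontr)
    assume no_tight: "\<not> ?thesis"
    have "i \<noteq> j" using less by auto
    define e :: "real ^ 'n" where "e = axis i 1 - axis j 1"
    have e: "vsum (x + e) A = vsum x A + of_bool (i \<in> A) - of_bool (j \<in> A)" for A
      by (simp add: vsum_def e_def axis_def sum.distrib sum_subtractf of_bool_def)
    have x_int: "x \<in> int_vecs" and x_le: "vsum x A \<le> f A" for A
      using x by (auto simp: int_base_polyhedron_def int_polyhedron_def)
    have "x + e \<in> int_vecs"
      using x_int by (auto simp: int_vecs_def e_def axis_def)
    moreover have "vsum (x + e) A \<le> f A" for A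
    proof (cases "i \<in> A \<and> j \<notin> A")
      case True
      \<comment> \<open>Integrality turns this strict slack into at least one unit, enough for the
        exchange.\<close>
      then have "vsum x A < f A" using no_tight x_le[of A] by fastforce
      then show ?thesis
        using int_less_imp_add_one_le[OF vsum_int[OF x_int] f_int] True by (simp add: e)
    next
      case False
      then show ?thesis using x_le[of A] by (auto simp: e)
    qed
    ultimately have "x + e \<in> int_base_polyhedron f"
      using x by (simp add: int_base_polyhedron_def int_polyhedron_def e)
    then have "(norm (x + b))\<^sup>2 \<le> (norm (x + b + e))\<^sup>2"
      using min[of "x + e"] by (simp only: add.assoc add.commute[of e b])
    also have "\<dots> = (norm (x + b))\<^sup>2 + 2 * inner (x + b) e + inner e e"
      by (simp add: power2_norm_eq_inner inner_add inner_commute)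
    also have "inner (x + b) e = x $ i + b $ i - (x $ j + b $ j)"
      by (simp add: e_def inner_diff_right inner_axis)
    also have "inner e e = 2"
      using \<open>i \<noteq> j\<close> by (simp add: e_def inner_diff_right inner_diff_left inner_axis_axis)
    finally have "0 \<le> 2 * (x $ i + b $ i - (x $ j + b $ j)) + 2" by simp
    then show False using less by simp
  qed
  with x that show thesis by blast
qed

text \<open>For every integer \<open>c\<close> some tight set contains all coordinates of \<open>x + b\<close> below \<open>c\<close> and none
  above \<open>c\<close>. Tightness makes the hinge sum at \<open>c\<close> a lower bound for all points of the polyhedron.\<close>

lemma ex_hinge_minimal_base:
  fixes f :: "'n::finite set \<Rightarrow> real"
  assumes "finite (int_base_polyhedron f)" "int_base_polyhedron f \<noteq> {}"
    and f_int: "\<And>A. f A \<in> \<int>" and f: "submodular f" and b: "b \<in> int_vecs"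
  obtains x where "x \<in> int_base_polyhedron f"
    "\<And>y c. y \<in> int_polyhedron f \<Longrightarrow> c \<in> \<int> \<Longrightarrow>
      (\<Sum>i\<in>UNIV. max 0 (c - (x + b) $ i)) \<le> (\<Sum>i\<in>UNIV. max 0 (c - (y + b) $ i))"
proof -
  obtain x where x: "x \<in> int_base_polyhedron f" and
    exch: "\<And>i j. x $ i + b $ i + 1 < x $ j + b $ j \<Longrightarrow> \<exists>T. vsum x T = f T \<and> i \<in> T \<and> j \<notin> T"
    using ex_exchange_optimal_base[OF assms(1,2) f_int] by metis
  have x_int: "x \<in> int_vecs" and x_le: "\<And>A. vsum x A \<le> f A" and x_UNIV: "vsum x UNIV = f UNIV"
    using x by (auto simp: int_base_polyhedron_def int_polyhedron_def)
  have z_int: "x $ i + b $ i \<in> \<int>" for i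
    using x_int b by (auto simp: int_vecs_def)
  have "(\<Sum>i\<in>UNIV. max 0 (c - (x + b) $ i)) \<le> (\<Sum>i\<in>UNIV. max 0 (c - (y + b) $ i))"
    if y: "y \<in> int_polyhedron f" and c: "c \<in> \<int>" for y c
  proof -
    obtain T where T: "vsum x T = f T" "{i. x $ i + b $ i < c} \<subseteq> T" "T \<inter> {j. c < x $ j + b $ j} = {}"
    proof (rule set_lattice_separation[of "{T. vsum x T = f T}"
          "{i. x $ i + b $ i < c}" "{j. c < x $ j + b $ j}"])
      \<comment> \<open>Uncrossing of tight sets: feasibility bounds each of the two sums by
        \<open>f\<close>, and submodularity leaves no room for strictness.\<close>
      have "vsum x (S \<union> T) = f (S \<union> T) \<and> vsum x (S \<inter> T) = f (S \<inter> T)"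
        if "vsum x S = f S" "vsum x T = f T" for S T
      proof -
        have "f (S \<union> T) + f (S \<inter> T) \<le> f S + f T"
          using f by (simp add: submodular_def)
        moreover have "vsum x (S \<union> T) + vsum x (S \<inter> T) = vsum x S + vsum x T"
          by (simp add: vsum_def sum.union_inter)
        ultimately show ?thesis using x_le[of "S \<union> T"] x_le[of "S \<inter> T"] that by linarith
      qed
      then show "S \<union> T \<in> {T. vsum x T = f T}" "S \<inter> T \<in> {T. vsum x T = f T}"
        if "S \<in> {T. vsum x T = f T}" "T \<in> {T. vsum x T = f T}" for S T
        using that by auto
      show "{} \<in> {T. vsum x T = f T}"
        using f by (simp add: submodular_def vsum_def)
      show "UNIV \<in> {T. vsum x T = f T}" using x_UNIV by simp
      fix i j assume "i \<in> {i. x $ i + b $ i < c}" "j \<in> {j. c < x $ j + b $ j}"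
      \<comment> \<open>Integrality puts \<open>c\<close> at least a full unit above the first
        value, which gives the gap that \<open>exch\<close> asks for.\<close>
      then have "x $ i + b $ i + 1 < x $ j + b $ j"
        using int_less_imp_add_one_le[OF z_int[of i] c] by auto
      from exch[OF this] show "\<exists>T\<in>{T. vsum x T = f T}. i \<in> T \<and> j \<notin> T" by auto
    qed auto
    \<comment> \<open>Values of \<open>x + b\<close> are at most \<open>c\<close> on
      \<open>T\<close> and at least \<open>c\<close> off \<open>T\<close>, so the hinge is affine on
      \<open>T\<close> and vanishes outside.\<close>
    have "(\<Sum>i\<in>UNIV. max 0 (c - (x + b) $ i)) = (\<Sum>i\<in>T. c - (x + b) $ i)"
    proof (rule sum.mono_neutral_cong_right)
      show "\<forall>i\<in>UNIV - T. max 0 (c - (x + b) $ i) = 0"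
      proof
        fix i assume "i \<in> UNIV - T"
        then have "\<not> x $ i + b $ i < c" using T(2) by blast
        then show "max 0 (c - (x + b) $ i) = 0" by simp
      qed
      show "max 0 (c - (x + b) $ i) = c - (x + b) $ i" if "i \<in> T" for i
      proof -
        have "\<not> c < x $ i + b $ i" using T(3) that by blast
        then show ?thesis by simp
      qed
    qed auto
    also have "\<dots> = (\<Sum>i\<in>T. c - b $ i) - f T"
      by (simp add: T(1)[symmetric] vsum_def sum_subtractf sum.distrib)
    also have "\<dots> \<le> (\<Sum>i\<in>T. c - b $ i) - vsum y T"
      using y by (simp add: int_polyhedron_def)
    also have "\<dots> = (\<Sum>i\<in>T. c - (y + b) $ i)"
      by (simp add: vsum_def sum_subtractf sum.distrib)
    also have "\<dots> \<le> (\<Sum>i\<in>T. max 0 (c - (y + b) $ i))"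
      by (intro sum_mono) simp
    also have "\<dots> \<le> (\<Sum>i\<in>UNIV. max 0 (c - (y + b) $ i))"
      by (intro sum_mono2) auto
    finally show ?thesis .
  qed
  with x that show thesis by blast
qed

section \<open>From hinge sums to Schur-convex minimizers\<close>

text \<open>At the \<open>k\<close>-th smallest entry of \<open>y\<close>, the hinge sum of
  \<open>y\<close> is exactly the affine sum over its \<open>k\<close> smallest entries, whereas
  that of \<open>x\<close> is at least the affine sum over any \<open>k\<close> coordinates.\<close>

lemma ascending_prefix_le_of_hinge_le:
  fixes x y :: "real ^ 'n"
  assumes \<pi>: "bij_betw \<pi> {..<CARD('n)} UNIV" and y: "ascending_enum \<rho> y"
    and hinge: "\<And>j. (\<Sum>i\<in>UNIV. max 0 (y $ j - x $ i)) \<le> (\<Sum>i\<in>UNIV. max 0 (y $ j - y $ i))"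
    and k: "k \<le> CARD('n)"
  shows "(\<Sum>i<k. y $ \<rho> i) \<le> (\<Sum>i<k. x $ \<pi> i)"
proof (cases "k = 0")
  case False
  let ?n = "CARD('n)"
  define c where "c = y $ \<rho> (k - 1)"
  have "(\<Sum>i<k. c - x $ \<pi> i) \<le> (\<Sum>i<k. max 0 (c - x $ \<pi> i))"
    by (intro sum_mono) simp
  also have "\<dots> \<le> (\<Sum>i<?n. max 0 (c - x $ \<pi> i))"
    using k by (intro sum_mono2) auto
  also have "\<dots> \<le> (\<Sum>i<?n. max 0 (c - y $ \<rho> i))"
    using hinge[of "\<rho> (k - 1)"] unfolding c_def
    by (simp add: sum_enum[OF \<pi>, of "\<lambda>i. max 0 (_ - x $ i)"]
        sum_enum[OF ascending_enum_bij[OF y], of "\<lambda>i. max 0 (_ - y $ i)"])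
  also have "\<dots> = (\<Sum>i<k. c - y $ \<rho> i)"
  proof (rule sum.mono_neutral_cong_right)
    show "\<forall>i\<in>{..<?n} - {..<k}. max 0 (c - y $ \<rho> i) = 0"
      using ascending_enum_le[OF y, of "k - 1"] by (auto simp: c_def)
    show "max 0 (c - y $ \<rho> i) = c - y $ \<rho> i" if "i \<in> {..<k}" for i
      using ascending_enum_le[OF y, of i "k - 1"] that k by (auto simp: c_def)
  qed (use k in auto)
  finally show ?thesis by (simp add: sum_subtractf)
qed simp

text \<open>Raising a largest entry of \<open>y\<close> until the totals agree leaves the sums of the smallest entries
  unchanged, so weak supermajorization becomes majorization.\<close>

lemma ex_ge_majorizing:
  fixes x y :: "real ^ 'n"
  assumes hinge: "\<And>j. (\<Sum>i\<in>UNIV. max 0 (y $ j - x $ i)) \<le> (\<Sum>i\<in>UNIV. max 0 (y $ j - y $ i))"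
  obtains y' where "y \<le> y'" "majorized x y'"
proof -
  let ?n = "CARD('n)"
  obtain \<pi> \<rho> where \<pi>: "ascending_enum \<pi> x" and \<rho>: "ascending_enum \<rho> y"
    using ex_ascending_enum by metis
  note bij = ascending_enum_bij[OF \<pi>] ascending_enum_bij[OF \<rho>]
  have le: "(\<Sum>i<k. y $ \<rho> i) \<le> (\<Sum>i<k. x $ \<pi> i)" if "k \<le> ?n" for k
    using ascending_prefix_le_of_hinge_le[OF bij(1) \<rho> hinge that] .
  have total: "vsum x UNIV = (\<Sum>i<?n. x $ \<pi> i)" "vsum y UNIV = (\<Sum>i<?n. y $ \<rho> i)"
    unfolding vsum_def by (rule sum_enum, fact bij)+
  define \<delta> where "\<delta> = vsum x UNIV - vsum y UNIV"
  have "0 \<le> \<delta>" using le[of ?n] total by (simp add: \<delta>_def)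
  \<comment> \<open>Position \<open>?n - 1\<close> holds a largest entry, so raising it by
    \<open>\<delta>\<close> keeps \<open>\<rho>\<close> ascending and affects only the full prefix
    sum.\<close>
  define y' where "y' = y + axis (\<rho> (?n - 1)) \<delta>"
  have y'_eq: "y' $ \<rho> i = y $ \<rho> i" if "i < ?n - 1" for i
  proof -
    have "\<rho> i \<noteq> \<rho> (?n - 1)"
      using that inj_on_eq_iff[OF bij_betw_imp_inj_on[OF bij(2)], of i "?n - 1"] by simp
    then show ?thesis by (simp add: y'_def axis_def)
  qed
  have y_le: "y $ i \<le> y' $ i" for i
    using \<open>0 \<le> \<delta>\<close> by (simp add: y'_def axis_def)
  have "y' $ \<rho> i \<le> y' $ \<rho> j" if ij: "i \<le> j" "j < ?n" for i j
  proof (cases "i = j")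
    case False
    then have "y' $ \<rho> i = y $ \<rho> i" using ij by (intro y'_eq) auto
    also have "\<dots> \<le> y $ \<rho> j" using ascending_enum_le[OF \<rho> ij] .
    also have "\<dots> \<le> y' $ \<rho> j" by (rule y_le)
    finally show ?thesis .
  qed simp
  then have \<rho>': "ascending_enum \<rho> y'" using bij(2) by (simp add: ascending_enum_def)
  have total': "vsum y' UNIV = vsum x UNIV"
    by (simp add: vsum_def y'_def sum.distrib axis_def \<delta>_def)
  have "(\<Sum>i<k. y' $ \<rho> i) \<le> (\<Sum>i<k. x $ \<pi> i)" if "k \<le> ?n" for k
  proof (cases "k = ?n")
    case True
    then show ?thesis
      using total total' sum_enum[OF bij(2), of "\<lambda>i. y' $ i"] by (simp add: vsum_def)
  next
    case False
    then have "(\<Sum>i<k. y' $ \<rho> i) = (\<Sum>i<k. y $ \<rho> i)"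
      using that by (intro sum.cong y'_eq) auto
    then show ?thesis using le[OF that] by simp
  qed
  then have "majorized x y'"
    using majorized_iff[OF \<pi> \<rho>'] total' by simp
  moreover have "y \<le> y'" using y_le by (simp add: less_eq_vec_def)
  ultimately show thesis by (rule that[rotated])
qed

text \<open>A hinge-minimal base \<open>x\<close> is chosen before \<open>\<Phi>\<close>. Each
  \<open>y + b\<close> is raised to some \<open>y'\<close> that majorizes \<open>x + b\<close>;
  Schur-convexity then compares \<open>x + b\<close> with \<open>y'\<close>, and monotonicity
  compares \<open>y'\<close> with \<open>y + b\<close>.\<close>

lemma lies_between_imp_schur_minimizer:
  fixes C :: "(real ^ 'n) set"
  assumes fin: "finite C" and btw: "lies_between_polyhedra C"
  shows "has_common_schur_minimizer C"
  unfolding has_common_schur_minimizer_def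
proof
  fix b :: "real ^ 'n" assume b: "b \<in> int_vecs"
  let ?f = "max_fun C"
  have f: "\<And>A. ?f A \<in> \<int>" "submodular ?f" and B_sub: "int_base_polyhedron ?f \<subseteq> C"
    and C_sub: "C \<subseteq> int_polyhedron ?f"
    using btw by (auto simp: lies_between_polyhedra_def)
  have "C \<noteq> {}"
  proof
    assume C: "C = {}"
    \<comment> \<open>\<open>max_fun {}\<close> is constant, hence equal to its value 0 at the empty set.\<close>
    have "?f A = 0" for A
      using f(2) by (simp add: submodular_def max_fun_def C)
    then have "0 \<in> int_base_polyhedron ?f"
      by (simp add: int_base_polyhedron_def int_polyhedron_def int_vecs_def vsum_def)
    then show False using B_sub C by auto
  qed
  \<comment> \<open>A point of \<open>C\<close> with maximal total is a base.\<close>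
  obtain x0 where "x0 \<in> C" "vsum x0 UNIV = ?f UNIV"
    using max_fun_attained[OF fin \<open>C \<noteq> {}\<close>] .
  then have "int_base_polyhedron ?f \<noteq> {}"
    using C_sub by (auto simp: int_base_polyhedron_def)
  then obtain x where x: "x \<in> int_base_polyhedron ?f" and
    hinge: "\<And>y c. y \<in> int_polyhedron ?f \<Longrightarrow> c \<in> \<int> \<Longrightarrow>
      (\<Sum>i\<in>UNIV. max 0 (c - (x + b) $ i)) \<le> (\<Sum>i\<in>UNIV. max 0 (c - (y + b) $ i))"
    using ex_hinge_minimal_base[OF finite_subset[OF B_sub fin] _ f b] by metis
  have "\<Phi> (x + b) \<le> \<Phi> (y + b)"
    if \<Phi>: "antimono \<Phi>" "schur_convex \<Phi>" and y: "y \<in> C" for \<Phi> :: "real ^ 'n \<Rightarrow> real" and y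
  proof -
    have y_in: "y \<in> int_polyhedron ?f" using y C_sub by auto
    \<comment> \<open>\<open>ex_ge_majorizing\<close> takes its hinge heights among these entries,
      and \<open>hinge\<close> covers integer heights.\<close>
    then have "(y + b) $ j \<in> \<int>" for j
      using b by (auto simp: int_polyhedron_def int_vecs_def)
    from hinge[OF y_in this] obtain y' where y': "y + b \<le> y'" "majorized (x + b) y'"
      by (rule ex_ge_majorizing)
    have "\<Phi> (x + b) \<le> \<Phi> y'" using \<Phi>(2) y'(2) by (simp add: schur_convex_def)
    also have "\<dots> \<le> \<Phi> (y + b)" using antimonoD[OF \<Phi>(1) y'(1)] .
    finally show ?thesis .
  qed
  then show "\<exists>x'\<in>C. \<forall>\<Phi> :: real ^ 'n \<Rightarrow> real. antimono \<Phi> \<and> continuous_on UNIV \<Phi> \<and> schur_convex \<Phi> \<longrightarrow>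
      (\<forall>x\<in>C. \<Phi> (x' + b) \<le> \<Phi> (x + b))"
    using x B_sub by (intro bexI[of _ x]) auto
qed

theorem theorem2:
  fixes C :: "(real ^ 'n) set"
  assumes "C \<subseteq> int_vecs" and "bounded C" and "hole_free C"
  shows "(has_least_weakly_supermajorized C \<longleftrightarrow> has_common_schur_minimizer C) \<and>
         (has_common_schur_minimizer C \<longleftrightarrow> has_prefix_sum_maximizer C) \<and>
         (has_prefix_sum_maximizer C \<longleftrightarrow> lies_between_polyhedra C)"
proof -
  note fin = finite_bounded_int_vecs[OF assms(1,2)]
  show ?thesis
    using schur_minimizer_imp_least_supermajorized[of C]
      least_supermajorized_imp_prefix_sum_maximizer[OF assms(2)]
      prefix_sum_maximizer_imp_lies_between[OF assms(1) fin assms(3)]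
      lies_between_imp_schur_minimizer[OF fin]
    by argo
qed

end
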